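(* For every integer $k\ge 0$, $$\sum_{n\ge 0}a(n,2k+1,t)\,x^n=\frac{\Phi_k(x,t)-x^2\Phi_{k-1}(x,t)}{\Phi_{k+1}(x,t)-x(x+1)\Phi_k(x,t)+x^3\Phi_{k-1}(x,t)}$$ as formal power series in $x$ (with coefficients polynomials in $t$).
   Context: Up-step $U:(i,j)\to(i+1,j+1)$, down-step $D:(i,j)\to(i+1,j-1)$. For integers $n,k\ge 0$, $A_{n,k}$ is the set of lattice paths of length $n$ consisting of $U$ and $D$ steps that start at $(0,0)$, end at height $0$ or $-1$, and stay in the strip $-\lfloor (k+1)/2\rfloor\le y\le \lfloor k/2\rfloor$. A peak of a path is a vertex preceded by a $U$ and followed by a $D$; a valley is a vertex preceded by a $D$ and followed by a $U$; the height of a vertex is its $y$-coordinate. The extremal points of a path $v$ are its peaks of height $\ge 1$ and its valleys of height $\le -2$; $e(v)$ is their number. Define $a(n,k,t)=\sum_{v\in A_{n,k}}t^{e(v)}$. Fibonacci polynomials: $F_0(x,s)=0$, $F_1(x,s)=1$, $F_n(x,s)=xF_{n-1}(x,s)+sF_{n-2}(x,s)$, so $F_n(x,s)=\sum_{j=0}^{\lfloor (n-1)/2\rfloor}\binom{n-1-j}{j}x^{n-1-2j}s^j$ for $n\ge1$; extending the recurrence backwards gives $F_{-1}(x,s)=1/s$. Set $\Phi_n(x,t)=F_n(1+(1-t)x^2,-x^2)$; in particular $\Phi_0=0$, $\Phi_1=1$ and $\Phi_{-1}(x,t)=-1/x^2$. *)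

theory Defs
  imports "HOL-Computational_Algebra.Computational_Algebra"
begin

datatype step = U | D

fun step_height :: "step \<Rightarrow> int" where
  "step_height U = 1"
| "step_height D = -1"

text \<open>A path starting at \<open>(0, 0)\<close> is represented by its list of steps;
  its vertices are \<open>(i, height v i)\<close> for \<open>i \<le> length v\<close>.\<close>

definition height :: "step list \<Rightarrow> nat \<Rightarrow> int" where
  "height v i = (\<Sum>s\<leftarrow>take i v. step_height s)"

definition strip_paths :: "nat \<Rightarrow> nat \<Rightarrow> step list set" where
  "strip_paths n k =
    {v. length v = n \<and> height v n \<in> {0, -1} \<and>
        (\<forall>i\<le>n. - ((int k + 1) div 2) \<le> height v i \<and> height v i \<le> int k div 2)}"

text \<open>The step before the \<open>i\<close>-th vertex is \<open>v ! (i - 1)\<close>, the step after it is \<open>v ! i\<close>.\<close>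

definition is_peak :: "step list \<Rightarrow> nat \<Rightarrow> bool" where
  "is_peak v i \<longleftrightarrow> 0 < i \<and> i < length v \<and> v ! (i - 1) = U \<and> v ! i = D"

definition is_valley :: "step list \<Rightarrow> nat \<Rightarrow> bool" where
  "is_valley v i \<longleftrightarrow> 0 < i \<and> i < length v \<and> v ! (i - 1) = D \<and> v ! i = U"

definition extremal_points :: "step list \<Rightarrow> nat set" where
  "extremal_points v =
    {i. is_peak v i \<and> height v i \<ge> 1 \<or> is_valley v i \<and> height v i \<le> -2}"

definition extremal_count :: "step list \<Rightarrow> nat" where
  "extremal_count v = card (extremal_points v)"

lemma finite_strip_paths: "finite (strip_paths n k)"
proof -
  have "(UNIV :: step set) = {U, D}"
    using step.exhaust by auto
  hence "finite (UNIV :: step set)"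
    by (metis finite.emptyI finite.insertI)
  hence "finite {v :: step list. set v \<subseteq> UNIV \<and> length v = n}"
    by (rule finite_lists_length_eq)
  thus ?thesis
    by (rule rev_finite_subset) (auto simp: strip_paths_def)
qed

lemma finite_extremal_points: "finite (extremal_points v)"
  by (rule finite_subset[of _ "{..<length v}"])
     (auto simp: extremal_points_def is_peak_def is_valley_def)

text \<open>A polynomial in \<open>t\<close>, the indeterminate of \<^typ>\<open>int poly\<close>.\<close>

definition path_poly :: "nat \<Rightarrow> nat \<Rightarrow> int poly" where
  "path_poly n k = (\<Sum>v\<in>strip_paths n k. monom 1 (extremal_count v))"

text \<open>Values of the Fibonacci polynomials \<open>F\<^sub>n(x, s)\<close> in a field. For \<open>n < 0\<close> the recurrence is
  solved for its last term, which requires \<open>s \<noteq> 0\<close>.\<close>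

function fib_poly :: "int \<Rightarrow> 'a :: field \<Rightarrow> 'a \<Rightarrow> 'a" where
  "fib_poly n x s =
    (if n = 0 then 0
     else if n = 1 then 1
     else if n > 1 then x * fib_poly (n - 1) x s + s * fib_poly (n - 2) x s
     else (fib_poly (n + 2) x s - x * fib_poly (n + 1) x s) / s)"
  by pat_completeness auto
termination
  by (relation "measure (\<lambda>(n, x, s). nat (if n \<ge> 0 then n else 2 - n))") auto

declare fib_poly.simps [simp del]

lemma fib_poly_0 [simp]: "fib_poly 0 x s = 0"
  by (simp add: fib_poly.simps)

lemma fib_poly_1 [simp]: "fib_poly 1 x s = 1"
  by (simp add: fib_poly.simps)

lemma fib_poly_minus_1: "fib_poly (-1) x s = 1 / s"
  by (subst fib_poly.simps) simp

lemma fib_poly_rec: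
  assumes "s \<noteq> 0"
  shows "fib_poly n x s = x * fib_poly (n - 1) x s + s * fib_poly (n - 2) x s"
proof (cases "n > 1")
  case True
  thus ?thesis by (subst fib_poly.simps) simp
next
  case False
  have "fib_poly (n - 2) x s = (fib_poly n x s - x * fib_poly (n - 1) x s) / s"
    using False by (subst fib_poly.simps) simp
  thus ?thesis using assms by simp
qed

text \<open>Everything takes place in the field of formal Laurent series in \<open>x\<close> over the field of
  fractions of \<open>\<int>[t]\<close>, since \<open>\<Phi>\<^sub>-\<^sub>1 = -1/x\<^sup>2\<close> is not a power series; \<open>x\<close> is \<^term>\<open>fls_X\<close>.\<close>

definition t_var :: "int poly fract fls" where
  "t_var = fls_const (to_fract [:0, 1:])"

definition Phi :: "int \<Rightarrow> int poly fract fls" where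
  "Phi n = fib_poly n (1 + (1 - t_var) * fls_X ^ 2) (- (fls_X ^ 2))"

lemma Phi_0: "Phi 0 = 0"
  and Phi_1: "Phi 1 = 1"
  and Phi_minus_1: "Phi (-1) = - 1 / fls_X ^ 2"
  by (simp_all add: Phi_def fib_poly_minus_1)

definition path_gf :: "nat \<Rightarrow> int poly fract fps" where
  "path_gf k = Abs_fps (\<lambda>n. to_fract (path_poly n k))"

end

theory Submission
  imports Defs
begin

text \<open>Let \<open>u\<^sub>h\<close> and \<open>d\<^sub>h\<close> be the generating functions of the paths in the strip that start at height
  \<open>h\<close>, where the start is regarded as preceded by an up-step or a down-step, respectively.
  Splitting off the first step gives, for \<open>1 \<le> h \<le> k\<close>,
  \<open>u\<^sub>h = x u\<^sub>h\<^sub>+\<^sub>1 + t x d\<^sub>h\<^sub>-\<^sub>1\<close> and \<open>d\<^sub>h = x u\<^sub>h\<^sub>+\<^sub>1 + x d\<^sub>h\<^sub>-\<^sub>1\<close>, hence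
  \<open>(1 + (1 - t) x\<^sup>2) d\<^sub>h = x d\<^sub>h\<^sub>+\<^sub>1 + x d\<^sub>h\<^sub>-\<^sub>1\<close>. This is a rescaled Fibonacci recurrence, so that
  \<open>x\<^sup>j d\<^sub>k\<^sub>-\<^sub>j = d\<^sub>k (\<Phi>\<^sub>j - x\<^sup>2 \<Phi>\<^sub>j\<^sub>-\<^sub>1)\<close>. The reflection \<open>y \<mapsto> -1 - y\<close> preserves the strip and the set of
  extremal points; at height \<open>0\<close> it yields \<open>d\<^sub>0 = 1 + x u\<^sub>1 + x d\<^sub>0\<close>, which determines the scale.\<close>

section \<open>Recursive description of path tails and their extremal points\<close>

fun strip_ok :: "nat \<Rightarrow> int \<Rightarrow> step list \<Rightarrow> bool" where
  "strip_ok k h [] \<longleftrightarrow> h = 0 \<or> h = -1"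
| "strip_ok k h (s # v) \<longleftrightarrow>
     - int k - 1 \<le> h \<and> h \<le> int k \<and> strip_ok k (h + step_height s) v"

definition is_extremal :: "int \<Rightarrow> step \<Rightarrow> step \<Rightarrow> bool" where
  "is_extremal h p s \<longleftrightarrow> p = U \<and> s = D \<and> 1 \<le> h \<or> p = D \<and> s = U \<and> h \<le> -2"

fun ext_count :: "int \<Rightarrow> step \<Rightarrow> step list \<Rightarrow> nat" where
  "ext_count h p [] = 0"
| "ext_count h p (s # v) = of_bool (is_extremal h p s) + ext_count (h + step_height s) s v"

definition tail_poly :: "nat \<Rightarrow> nat \<Rightarrow> int \<Rightarrow> step \<Rightarrow> int poly" where
  "tail_poly k n h p =
    (\<Sum>v | length v = n \<and> strip_ok k h v. monom 1 (ext_count h p v))"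

lemma height_0 [simp]: "height v 0 = 0"
  by (simp add: height_def)

lemma height_Cons_Suc [simp]: "height (s # v) (Suc i) = step_height s + height v i"
  by (simp add: height_def)

text \<open>The heights \<open>0\<close> and \<open>-1\<close> lie in the strip for every
  \<open>k\<close>, which is why the clause for \<open>[]\<close> tests no bounds.\<close>

lemma strip_ok_iff:
  "strip_ok k h v \<longleftrightarrow> h + height v (length v) \<in> {0, -1} \<and>
     (\<forall>i\<le>length v. - int k - 1 \<le> h + height v i \<and> h + height v i \<le> int k)"
proof (induction v arbitrary: h)
  case (Cons s v)
  have split: "(\<forall>i\<le>Suc n. P i) \<longleftrightarrow> P 0 \<and> (\<forall>i\<le>n. P (Suc i))" for n and P :: "nat \<Rightarrow> bool"
    using less_Suc_eq_0_disj by (metis Suc_le_mono le0 not0_implies_Suc)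
  show ?case
    by (simp only: strip_ok.simps Cons.IH length_Cons split height_Cons_Suc height_0)
       (auto simp: add.assoc)
qed auto

lemma strip_paths_eq: "strip_paths n (2 * k + 1) = {v. length v = n \<and> strip_ok k 0 v}"
proof -
  have "(int (2 * k + 1) + 1) div 2 = int k + 1" "int (2 * k + 1) div 2 = int k"
    by simp_all
  thus ?thesis
    unfolding strip_paths_def strip_ok_iff by auto
qed

text \<open>Prepending \<open>p\<close> makes \<open>(p # v) ! i\<close> the step before vertex
  \<open>i\<close>, also for \<open>i = 0\<close>.\<close>

lemma ext_count_eq_card:
  "ext_count h p v = card {i. i < length v \<and> is_extremal (h + height v i) ((p # v) ! i) (v ! i)}"
proof (induction v arbitrary: h p)
  case (Cons s v)
  define M where "M = {i. is_extremal (h + height (s # v) i) ((p # s # v) ! i) ((s # v) ! i)}"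
  have tail: "ext_count (h + step_height s) s v = card {i. Suc i \<in> M \<and> i < length v}"
    by (simp add: Cons.IH M_def add.assoc conj_commute)
  have "card {i \<in> M. i < Suc (length v)} =
      of_bool (0 \<in> M) + card {i. Suc i \<in> M \<and> i < length v}"
    using card_less_Suc[of M "length v"] card_less_Suc2[of M "length v"] by (cases "0 \<in> M") auto
  moreover have "0 \<in> M \<longleftrightarrow> is_extremal h p s"
    by (simp add: M_def)
  moreover have "{i \<in> M. i < Suc (length v)} =
      {i. i < length (s # v) \<and>
        is_extremal (h + height (s # v) i) ((p # s # v) ! i) ((s # v) ! i)}"
    by (auto simp: M_def)
  ultimately show ?case
    by (simp add: tail)
qed simp

text \<open>The origin is not extremal at all, so any \<open>p\<close> may be put in front of it.\<close>

lemma extremal_count_eq: "extremal_count v = ext_count 0 p v"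
proof -
  have "extremal_points v =
      {i. i < length v \<and> is_extremal (0 + height v i) ((p # v) ! i) (v ! i)}"
    by (auto simp: extremal_points_def is_extremal_def is_peak_def is_valley_def nth_Cons'
        intro!: gr0I)
  thus ?thesis
    by (simp only: extremal_count_def ext_count_eq_card)
qed

lemma path_poly_eq: "path_poly n (2 * k + 1) = tail_poly k n 0 p"
  by (simp only: path_poly_def tail_poly_def strip_paths_eq extremal_count_eq[of _ p])

lemma tail_poly_0: "tail_poly k 0 h p = of_bool (h = 0 \<or> h = -1)"
proof -
  have "{v. length v = 0 \<and> strip_ok k h v} = (if h = 0 \<or> h = -1 then {[]} else {})"
    by auto
  thus ?thesis
    by (simp add: tail_poly_def)
qed

lemma tail_poly_outside: "h > int k \<or> h < - int k - 1 \<Longrightarrow> tail_poly k n h p = 0"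
proof -
  assume "h > int k \<or> h < - int k - 1"
  hence "\<not> strip_ok k h v" for v
    by (cases v) auto
  thus ?thesis
    by (simp add: tail_poly_def)
qed

lemma finite_lists_step: "finite {v :: step list. length v = n \<and> P v}"
proof -
  have "(UNIV :: step set) = {U, D}"
    using step.exhaust by auto
  hence "finite (UNIV :: step set)"
    by (metis finite.emptyI finite.insertI)
  from finite_lists_length_eq[OF this, of n] show ?thesis
    by (rule rev_finite_subset) auto
qed

lemma tail_poly_Suc:
  assumes "- int k - 1 \<le> h" "h \<le> int k"
  shows "tail_poly k (Suc n) h p =
    monom 1 (of_bool (is_extremal h p U)) * tail_poly k n (h + 1) U +
    monom 1 (of_bool (is_extremal h p D)) * tail_poly k n (h - 1) D"
proof -
  let ?S = "\<lambda>s. {v. length v = n \<and> strip_ok k (h + step_height s) v}"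
  have split: "{v. length v = Suc n \<and> strip_ok k h v} = (#) U ` ?S U \<union> (#) D ` ?S D"
  proof -
    have "v \<in> (#) U ` ?S U \<union> (#) D ` ?S D" if v: "length v = Suc n" "strip_ok k h v" for v
    proof (cases v)
      case (Cons s w)
      with v show ?thesis by (cases s) auto
    qed (use v in auto)
    thus ?thesis
      using assms by auto
  qed
  have part: "(\<Sum>v\<in>(#) s ` ?S s. monom 1 (ext_count h p v)) =
      monom 1 (of_bool (is_extremal h p s)) * tail_poly k n (h + step_height s) s" for s
    by (subst sum.reindex)
       (auto simp: tail_poly_def sum_distrib_left mult_monom)
  have "tail_poly k (Suc n) h p =
      (\<Sum>v\<in>(#) U ` ?S U. monom 1 (ext_count h p v)) +
      (\<Sum>v\<in>(#) D ` ?S D. monom 1 (ext_count h p v))"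
    unfolding tail_poly_def split
    by (rule sum.union_disjoint) (auto intro!: finite_imageI finite_lists_step)
  thus ?thesis
    by (simp only: part) simp
qed

text \<open>Reflection swaps the two summands of \<open>tail_poly_Suc\<close>, and the weights match
  because \<open>1 \<le> h\<close> iff \<open>- 1 - h \<le> -2\<close>.\<close>

lemma tail_poly_reflect: "tail_poly k n h U = tail_poly k n (- 1 - h) D"
proof (induction n arbitrary: h)
  case 0
  show ?case by (auto simp: tail_poly_0)
next
  case (Suc n)
  show ?case
  proof (cases "- int k - 1 \<le> h \<and> h \<le> int k")
    case True
    have "tail_poly k n (h + 1) U = tail_poly k n (- 1 - h - 1) D"
      by (simp add: Suc.IH)
    moreover have "tail_poly k n (- 1 - h + 1) U = tail_poly k n (h - 1) D"
      by (simp add: Suc.IH)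
    moreover have "is_extremal (- 1 - h) D U \<longleftrightarrow> is_extremal h U D"
      by (auto simp: is_extremal_def)
    ultimately show ?thesis
      using True by (simp add: tail_poly_Suc) (simp add: is_extremal_def)
  qed (auto simp: tail_poly_outside)
qed

section \<open>Generating functions of path tails\<close>

definition tail_gf :: "nat \<Rightarrow> int \<Rightarrow> step \<Rightarrow> int poly fract fls" where
  "tail_gf k h p = fps_to_fls (Abs_fps (\<lambda>n. to_fract (tail_poly k n h p)))"

lemma path_gf_eq: "fps_to_fls (path_gf (2 * k + 1)) = tail_gf k 0 p"
  by (simp only: path_gf_def tail_gf_def path_poly_eq[of _ k p])

lemma tail_gf_outside: "h > int k \<or> h < - int k - 1 \<Longrightarrow> tail_gf k h p = 0"
  by (simp add: tail_gf_def tail_poly_outside flip: fps_zero_def)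

lemma tail_gf_reflect: "tail_gf k h U = tail_gf k (- 1 - h) D"
  by (simp add: tail_gf_def tail_poly_reflect)

lemma tail_gf_rec:
  assumes "- int k - 1 \<le> h" "h \<le> int k"
  shows "tail_gf k h p = of_bool (h = 0 \<or> h = -1) +
    fls_X * ((if is_extremal h p U then t_var else 1) * tail_gf k (h + 1) U +
             (if is_extremal h p D then t_var else 1) * tail_gf k (h - 1) D)"
proof -
  let ?w = "\<lambda>b. fps_const (to_fract (if b then [:0, 1:] else 1 :: int poly))"
  let ?f = "\<lambda>h p. Abs_fps (\<lambda>n. to_fract (tail_poly k n h p))"
  have m: "monom 1 (of_bool b) = (if b then [:0, 1:] else 1 :: int poly)" for b
    by (simp add: monom_altdef)
  have "?f h p = of_bool (h = 0 \<or> h = -1) +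
      fps_X * (?w (is_extremal h p U) * ?f (h + 1) U + ?w (is_extremal h p D) * ?f (h - 1) D)"
    (is "?l = ?r")
  proof (rule fps_ext)
    fix n
    show "fps_nth ?l n = fps_nth ?r n"
      by (cases n) (auto simp: tail_poly_0 tail_poly_Suc[OF assms] m)
  qed
  moreover have "fps_to_fls (?w b) = (if b then t_var else 1)" for b
    by (simp add: t_var_def)
  ultimately show ?thesis
    by (simp add: tail_gf_def fls_times_fps_to_fls)
qed

section \<open>The Fibonacci side\<close>

definition strip_num :: "int \<Rightarrow> int poly fract fls" where
  "strip_num n = Phi n - fls_X ^ 2 * Phi (n - 1)"

lemma Phi_rec:
  "Phi n = (1 + (1 - t_var) * fls_X ^ 2) * Phi (n - 1) - fls_X ^ 2 * Phi (n - 2)"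
  unfolding Phi_def by (subst fib_poly_rec) simp_all

text \<open>The value at \<open>0\<close> rests on the backward extension \<open>Phi (-1)\<close>;
  with \<open>strip_num_1\<close> it starts the recurrence.\<close>

lemma strip_num_0 [simp]: "strip_num 0 = 1"
proof -
  have "fls_X ^ 2 \<noteq> (0 :: int poly fract fls)"
    by (simp only: power_not_zero fls_X_nonzero not_False_eq_True)
  hence "fls_X ^ 2 * (- 1 / fls_X ^ 2) = (- 1 :: int poly fract fls)"
    by (metis nonzero_mult_div_cancel_left times_divide_eq_right)
  thus ?thesis
    by (simp only: strip_num_def Phi_0 diff_0 Phi_minus_1 minus_minus)
qed

lemma strip_num_1 [simp]: "strip_num 1 = 1"
  by (simp add: strip_num_def Phi_0 Phi_1)

text \<open>\<open>Phi\<close> and its shift satisfy the same linear recurrence, hence so does their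
  combination.\<close>

lemma strip_num_rec:
  "strip_num (n + 1) =
    (1 + (1 - t_var) * fls_X ^ 2) * strip_num n - fls_X ^ 2 * strip_num (n - 1)"
proof -
  define q :: "int poly fract fls" where "q = 1 + (1 - t_var) * fls_X ^ 2"
  have "Phi (n + 1) = q * Phi n - fls_X ^ 2 * Phi (n - 1)"
    using Phi_rec[of "n + 1"] by (simp add: q_def)
  hence "strip_num (n + 1) = q * Phi n - fls_X ^ 2 * Phi (n - 1) - fls_X ^ 2 * Phi n"
    by (simp add: strip_num_def)
  also have "\<dots> = q * Phi n - fls_X ^ 2 * Phi (n - 1) -
      fls_X ^ 2 * (q * Phi (n - 1) - fls_X ^ 2 * Phi (n - 2))"
    using Phi_rec[of n] by (simp add: q_def)
  also have "\<dots> = q * strip_num n - fls_X ^ 2 * strip_num (n - 1)"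
    by (simp add: strip_num_def algebra_simps)
  finally show ?thesis
    by (simp only: q_def)
qed

section \<open>Solving the recurrences from the top of the strip downwards\<close>

text \<open>At positive height the two first-step recurrences differ only in the weight of a
  down-step: \<open>t_var\<close> after \<open>U\<close> (a peak), \<open>1\<close> after
  \<open>D\<close>.\<close>

lemma tail_gf_U_eq:
  assumes "1 \<le> h" "h \<le> int k"
  shows "tail_gf k h U = tail_gf k h D - (1 - t_var) * fls_X * tail_gf k (h - 1) D"
  using assms tail_gf_rec[of k h U] tail_gf_rec[of k h D]
  by (simp add: is_extremal_def algebra_simps)

text \<open>An up-step would leave the strip, and \<open>1 \<le> k\<close> excludes the empty
  path.\<close>

lemma tail_gf_D_top:
  assumes "1 \<le> k"
  shows "tail_gf k (int k) D = fls_X * tail_gf k (int k - 1) D"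
  using assms tail_gf_rec[of k "int k" D] by (simp add: is_extremal_def tail_gf_outside)

lemma tail_gf_D_rec:
  assumes "1 \<le> h" "h < int k"
  shows "fls_X * tail_gf k (h - 1) D =
    (1 + (1 - t_var) * fls_X ^ 2) * tail_gf k h D - fls_X * tail_gf k (h + 1) D"
proof -
  have "tail_gf k h D = fls_X * (tail_gf k (h + 1) U + tail_gf k (h - 1) D)"
    using assms tail_gf_rec[of k h D] by (simp add: is_extremal_def)
  moreover have "tail_gf k (h + 1) U =
      tail_gf k (h + 1) D - (1 - t_var) * fls_X * tail_gf k h D"
    using assms tail_gf_U_eq[of "h + 1" k] by simp
  ultimately show ?thesis
    by algebra
qed

lemma tail_gf_D_eq:
  "j \<le> k \<Longrightarrow> fls_X ^ j * tail_gf k (int k - int j) D = tail_gf k (int k) D * strip_num (int j)"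
proof (induction j rule: less_induct)
  case (less j)
  consider "j = 0" | "j = 1" | i where "j = Suc (Suc i)"
    by (metis One_nat_def not0_implies_Suc)
  thus ?case
  proof cases
    case (3 i)
    define d where "d l = tail_gf k (int k - int l) D" for l
    define q :: "int poly fract fls" where "q = 1 + (1 - t_var) * fls_X ^ 2"
    have IH: "fls_X ^ i * d i = d 0 * strip_num (int i)"
      "fls_X ^ Suc i * d (Suc i) = d 0 * strip_num (int (Suc i))"
      using less.IH[of i] less.IH[of "Suc i"] less.prems 3 by (simp_all add: d_def)
    \<comment> \<open>Since \<open>j = i + 2 \<le> k\<close>, the height
      \<open>int k - int (Suc i)\<close> is at least \<open>1\<close> and below
      \<open>int k\<close>.\<close>
    have "fls_X * d j = q * d (Suc i) - fls_X * d i"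
      using tail_gf_D_rec[of "int k - int (Suc i)" k] less.prems 3
      by (simp add: d_def q_def algebra_simps)
    hence "fls_X ^ j * d j = fls_X ^ Suc i * (q * d (Suc i) - fls_X * d i)"
      by (metis 3 mult.assoc power_Suc2)
    also have "\<dots> = q * (fls_X ^ Suc i * d (Suc i)) - fls_X ^ 2 * (fls_X ^ i * d i)"
      by (simp add: algebra_simps power2_eq_square)
    also have "\<dots> = d 0 * (q * strip_num (int (Suc i)) - fls_X ^ 2 * strip_num (int i))"
      by (simp only: IH) (simp add: algebra_simps)
    also have "\<dots> = d 0 * strip_num (int j)"
      using strip_num_rec[of "int (Suc i)"] by (simp add: 3 q_def add.commute)
    finally show ?thesis
      by (simp add: d_def)
  qed (use less.prems tail_gf_D_top in simp_all)
qed

text \<open>The first step down leads to height \<open>-1\<close>. Reflection turns that tail into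
  the one at height \<open>0\<close> after \<open>U\<close>, which equals the one after
  \<open>D\<close> since the origin is never extremal.\<close>

lemma tail_gf_0_eq:
  "tail_gf k 0 D = 1 + fls_X * tail_gf k 1 U + fls_X * tail_gf k 0 D"
  using tail_gf_rec[of k 0 D] tail_gf_reflect[of k 0] path_gf_eq[of k U] path_gf_eq[of k D]
  by (simp add: is_extremal_def algebra_simps)

lemma strip_den_scale:
  "tail_gf k (int k) D * (strip_num (int k + 1) - fls_X * strip_num (int k)) = fls_X ^ k"
proof (cases k)
  case 0
  \<comment> \<open>Here height \<open>1\<close> is outside the strip, so the \<open>U\<close> term
    vanishes.\<close>
  then show ?thesis
    using tail_gf_0_eq[of 0] by (simp add: tail_gf_outside algebra_simps)
next
  case (Suc m)
  define c where "c = tail_gf k (int k) D"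
  have d0: "fls_X ^ k * tail_gf k 0 D = c * strip_num (int k)"
    using tail_gf_D_eq[of k k] by (simp add: c_def)
  have d1: "fls_X ^ m * tail_gf k 1 D = c * strip_num (int m)"
    using tail_gf_D_eq[of m k] Suc by (simp add: c_def)
  have num: "strip_num (int k + 1) =
      (1 + (1 - t_var) * fls_X ^ 2) * strip_num (int k) - fls_X ^ 2 * strip_num (int m)"
    using strip_num_rec[of "int k"] Suc by simp
  \<comment> \<open>Eliminating \<open>tail_gf k 1 U\<close> leaves a boundary condition in
    \<open>D\<close> tails only, which fixes \<open>c\<close>.\<close>
  have one: "(1 - fls_X + (1 - t_var) * fls_X ^ 2) * tail_gf k 0 D - fls_X * tail_gf k 1 D = 1"
  proof -
    have "tail_gf k 1 U = tail_gf k 1 D - (1 - t_var) * fls_X * tail_gf k 0 D"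
      using tail_gf_U_eq[of 1 k] Suc by simp
    with tail_gf_0_eq[of k] show ?thesis
      by algebra
  qed
  have "c * (strip_num (int k + 1) - fls_X * strip_num (int k)) =
      (1 - fls_X + (1 - t_var) * fls_X ^ 2) * (c * strip_num (int k)) -
      fls_X ^ 2 * (c * strip_num (int m))"
    unfolding num by (simp add: algebra_simps)
  also have "\<dots> = fls_X ^ k *
      ((1 - fls_X + (1 - t_var) * fls_X ^ 2) * tail_gf k 0 D - fls_X * tail_gf k 1 D)"
    \<comment> \<open>As \<open>k = Suc m\<close>, the product \<open>fls_X ^ 2 * fls_X ^ m\<close>
      is \<open>fls_X ^ k * fls_X\<close>.\<close>
    by (simp only: d0[symmetric] d1[symmetric])
       (simp add: Suc algebra_simps power2_eq_square)
  finally show ?thesis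
    by (simp add: one c_def)
qed

theorem theorem1:
  fixes k :: nat
  shows "fps_to_fls (path_gf (2 * k + 1)) =
    (Phi (int k) - fls_X ^ 2 * Phi (int k - 1)) /
    (Phi (int k + 1) - fls_X * (fls_X + 1) * Phi (int k) + fls_X ^ 3 * Phi (int k - 1))"
proof -
  define c where "c = tail_gf k (int k) D"
  define den where "den = strip_num (int k + 1) - fls_X * strip_num (int k)"
  have scale: "c * den = fls_X ^ k"
    using strip_den_scale by (simp add: c_def den_def)
  \<comment> \<open>A power of \<open>fls_X\<close> is nonzero, so \<open>c\<close> can be cancelled
    and the denominator of the theorem is invertible.\<close>
  hence nz: "c \<noteq> 0" "den \<noteq> 0"
    by auto
  have "c * den * tail_gf k 0 D = c * strip_num (int k)"
    unfolding scale using tail_gf_D_eq[of k k] by (simp add: c_def)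
  hence "den * tail_gf k 0 D = strip_num (int k)"
    using nz by (simp add: mult.assoc)
  hence "tail_gf k 0 D = strip_num (int k) / den"
    using nz by (simp add: field_simps)
  moreover have "den =
      Phi (int k + 1) - fls_X * (fls_X + 1) * Phi (int k) + fls_X ^ 3 * Phi (int k - 1)"
    by (simp add: den_def strip_num_def algebra_simps power2_eq_square power3_eq_cube)
  ultimately show ?thesis
    by (simp only: path_gf_eq[of k D] strip_num_def)
qed

end
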